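(* Let $\Gamma$ be a cofinite discrete subgroup of $\mathrm{SL}_2(\mathbb{R})$ with cusps, let $r\in\mathbb{C}$ and let $v$ be a multiplier system for the weight $r$. For $F\in A_r(\Gamma,v)$ the following are equivalent: (a) the image of the cohomology class $[\psi^{z_0}_F]\in H^1(\Gamma;\mathcal{D}^\omega_{v,2-r})$ under the natural map $H^1(\Gamma;\mathcal{D}^\omega_{v,2-r})\to H^1(\Gamma;\mathcal{D}^{-\omega}_{v,2-r})$ vanishes; (b) there exists $H\in\mathcal{H}_{2-\bar r}(\Gamma,\bar v)$ with $2i\,y^{2-r}\,\overline{\partial_{\bar z}H}=F$.
   Context: $\mathbb{H}$ upper, $\mathbb{H}^-$ lower half-plane; $\Gamma\ni -I$ discrete with $\Gamma\backslash\mathbb{H}$ of finite volume, noncompact. Argument convention: $\arg(cz+d)\in(-\pi,\pi]$ for $z\in\mathbb{H}$, $\in[-\pi,\pi)$ for $z\in\mathbb{H}^-$. A multiplier system for weight $r$ is $v:\Gamma\to\mathbb{C}^*$ such that $j(\gamma,z)=v(\gamma)(cz+d)^r$ satisfies $j(\gamma\delta,z)=j(\gamma,\delta z)j(\delta,z)$ and $j(-\gamma,z)=j(\gamma,z)$. $A_r(\Gamma,v)$: holomorphic $F$ on $\mathbb{H}$ with $v(\gamma)^{-1}(cz+d)^{-r}F(\gamma z)=F(z)$ for all $\gamma=\begin{pmatrix}*&*\\c&d\end{pmatrix}\in\Gamma$. Action on functions on $\mathbb{H}^-$: $(\varphi|_{v,2-r}\gamma)(t)=v(\gamma)^{-1}(ct+d)^{r-2}\varphi(\gamma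 t)$. $\mathcal{D}^{-\omega}_{v,2-r}$: all holomorphic functions on $\mathbb{H}^-$ with this action. $\mathcal{D}^\omega_{v,2-r}$: the subspace of those $\varphi$ for which $(i-t)^{2-r}\varphi(t)$ ($\arg(i-t)\in(-\pi/2,3\pi/2)$) extends holomorphically to an open neighbourhood of $\mathbb{H}^-\cup\mathbb{P}^1(\mathbb{R})$ in $\mathbb{P}^1(\mathbb{C})$. $\psi^{z_0}_{F,\gamma}(t)=\int_{\gamma^{-1}z_0}^{z_0}(z-t)^{r-2}F(z)dz$ ($z_0\in\mathbb{H}$ fixed, $-\pi/2<\arg(z-t)<3\pi/2$); $\gamma\mapsto\psi^{z_0}_{F,\gamma}$ is a cocycle with values in $\mathcal{D}^\omega_{v,2-r}$. For $p\in\mathbb{C}$, $\Delta_p=-4y^2\partial_z\partial_{\bar z}+2ipy\partial_{\bar z}$. $\mathcal{H}_{2-\bar r}(\Gamma,\bar v)$ is the space of $C^2$ functions $H$ on $\mathbb{H}$ with $\Delta_{2-\bar r}H=0$ and $\overline{v(\gamma)}^{-1}(cz+d)^{\bar r-2}H(\gamma z)=H(z)$ for all $\gamma\in\Gamma$. *)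

theory Defs
  imports "HOL-Complex_Analysis.Complex_Analysis"
begin

type_synonym mat2 = "real^2^2"

definition upper :: "complex set" where "upper = {z. Im z > 0}"
definition lower :: "complex set" where "lower = {z. Im z < 0}"

definition mat_a :: "mat2 \<Rightarrow> real" where "mat_a g = g $ 1 $ 1"
definition mat_b :: "mat2 \<Rightarrow> real" where "mat_b g = g $ 1 $ 2"
definition mat_c :: "mat2 \<Rightarrow> real" where "mat_c g = g $ 2 $ 1"
definition mat_d :: "mat2 \<Rightarrow> real" where "mat_d g = g $ 2 $ 2"

definition moeb :: "mat2 \<Rightarrow> complex \<Rightarrow> complex" where
  "moeb g z = (of_real (mat_a g) * z + of_real (mat_b g)) / (of_real (mat_c g) * z + of_real (mat_d g))"

definition cfac :: "mat2 \<Rightarrow> complex \<Rightarrow> complex" where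
  "cfac g z = of_real (mat_c g) * z + of_real (mat_d g)"

text \<open>Powers: on the upper half plane the principal branch (arg in (-pi,pi]) is used,
  which is Isabelle's complex powr. On the lower half plane the convention is arg in [-pi,pi),
  which differs from the principal branch exactly on the negative real axis.\<close>
definition powL :: "complex \<Rightarrow> complex \<Rightarrow> complex" where
  "powL w s = (if Im w = 0 \<and> Re w < 0
      then exp (s * (of_real (ln (- Re w)) - \<i> * of_real pi)) else w powr s)"

definition discrete_subgroup_SL2 :: "mat2 set \<Rightarrow> bool" where
  "discrete_subgroup_SL2 G \<longleftrightarrow>
     (\<forall>g\<in>G. det g = 1) \<and> mat 1 \<in> G \<and>
     (\<forall>g\<in>G. \<forall>h\<in>G. g ** h \<in> G) \<and> (\<forall>g\<in>G. matrix_inv g \<in> G) \<and>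
     (\<forall>g\<in>G. \<exists>e>0. \<forall>h\<in>G. dist h g < e \<longrightarrow> h = g)"

definition hyp_area :: "complex set \<Rightarrow> ennreal" where
  "hyp_area S = (\<integral>\<^sup>+ z. indicator S z * ennreal (1 / (Im z)\<^sup>2) \<partial>lborel)"

text \<open>Finite covolume: some Lebesgue measurable subset of H of finite hyperbolic area
  has Gamma-translates covering H (equivalently Gamma\H has finite hyperbolic volume).\<close>
definition cofinite :: "mat2 set \<Rightarrow> bool" where
  "cofinite G \<longleftrightarrow> (\<exists>S. S \<subseteq> upper \<and> S \<in> sets lebesgue \<and> hyp_area S < \<infinity> \<and>
                       (\<Union>g\<in>G. moeb g ` S) = upper)"

text \<open>Gamma\H is noncompact: no compact subset of H has Gamma-translates covering H.\<close>
definition has_cusps :: "mat2 set \<Rightarrow> bool" where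
  "has_cusps G \<longleftrightarrow> \<not> (\<exists>K. compact K \<and> K \<subseteq> upper \<and> (\<Union>g\<in>G. moeb g ` K) = upper)"

definition cofinite_with_cusps :: "mat2 set \<Rightarrow> bool" where
  "cofinite_with_cusps G \<longleftrightarrow> discrete_subgroup_SL2 G \<and> - mat 1 \<in> G \<and> cofinite G \<and> has_cusps G"

definition jfac :: "(mat2 \<Rightarrow> complex) \<Rightarrow> complex \<Rightarrow> mat2 \<Rightarrow> complex \<Rightarrow> complex" where
  "jfac v r g z = v g * cfac g z powr r"

definition multiplier_system :: "mat2 set \<Rightarrow> complex \<Rightarrow> (mat2 \<Rightarrow> complex) \<Rightarrow> bool" where
  "multiplier_system G r v \<longleftrightarrow>
     (\<forall>g\<in>G. v g \<noteq> 0) \<and>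
     (\<forall>g\<in>G. \<forall>h\<in>G. \<forall>z\<in>upper. jfac v r (g ** h) z = jfac v r g (moeb h z) * jfac v r h z) \<and>
     (\<forall>g\<in>G. \<forall>z\<in>upper. jfac v r (- g) z = jfac v r g z)"

definition A_space :: "mat2 set \<Rightarrow> complex \<Rightarrow> (mat2 \<Rightarrow> complex) \<Rightarrow> (complex \<Rightarrow> complex) set" where
  "A_space G r v = {F. F holomorphic_on upper \<and>
     (\<forall>g\<in>G. \<forall>z\<in>upper. inverse (v g) * cfac g z powr (- r) * F (moeb g z) = F z)}"

definition slash_lower :: "(mat2 \<Rightarrow> complex) \<Rightarrow> complex \<Rightarrow> mat2 \<Rightarrow> (complex \<Rightarrow> complex) \<Rightarrow> complex \<Rightarrow> complex" where
  "slash_lower v r g \<phi> t = inverse (v g) * powL (cfac g t) (r - 2) * \<phi> (moeb g t)"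

definition D_minus_omega :: "(complex \<Rightarrow> complex) set" where
  "D_minus_omega = {\<phi>. \<phi> holomorphic_on lower}"

text \<open>D^{omega}_{v,2-r}: (i-t)^{2-r} phi(t) extends holomorphically to a neighbourhood of
  the closure of the lower half plane in P^1(C) (including infinity).\<close>
definition D_omega :: "complex \<Rightarrow> (complex \<Rightarrow> complex) set" where
  "D_omega r = {\<phi>. \<phi> holomorphic_on lower \<and>
     (\<exists>U g e h. open U \<and> {t. Im t \<le> 0} \<subseteq> U \<and> g holomorphic_on U \<and>
        (\<forall>t\<in>lower. g t = (\<i> - t) powr (2 - r) * \<phi> t) \<and>
        e > 0 \<and> (\<forall>w. 0 < norm w \<and> norm w < e \<longrightarrow> 1 / w \<in> U) \<and>
        h holomorphic_on ball 0 e \<and> (\<forall>w. 0 < norm w \<and> norm w < e \<longrightarrow> h w = g (1 / w)))}"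

definition psi :: "complex \<Rightarrow> complex \<Rightarrow> (complex \<Rightarrow> complex) \<Rightarrow> mat2 \<Rightarrow> complex \<Rightarrow> complex" where
  "psi z0 r F g t = contour_integral (linepath (moeb (matrix_inv g) z0) z0) (\<lambda>z. (z - t) powr (r - 2) * F z)"

text \<open>A 1-cocycle c: Gamma -> M (functions on the lower half plane, right action) represents
  the zero class in H^1(Gamma; M) iff it is a coboundary.\<close>
definition coboundary_in :: "mat2 set \<Rightarrow> (mat2 \<Rightarrow> (complex \<Rightarrow> complex) \<Rightarrow> complex \<Rightarrow> complex)
      \<Rightarrow> (complex \<Rightarrow> complex) set \<Rightarrow> (mat2 \<Rightarrow> complex \<Rightarrow> complex) \<Rightarrow> bool" where
  "coboundary_in G act M c \<longleftrightarrow>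
     (\<exists>\<phi>\<in>M. \<forall>g\<in>G. \<forall>t\<in>lower. c g t = act g \<phi> t - \<phi> t)"

definition image_class_vanishes :: "mat2 set \<Rightarrow> complex \<Rightarrow> (mat2 \<Rightarrow> complex) \<Rightarrow> complex \<Rightarrow> (complex \<Rightarrow> complex) \<Rightarrow> bool" where
  "image_class_vanishes G r v z0 F \<longleftrightarrow> coboundary_in G (slash_lower v r) D_minus_omega (psi z0 r F)"

definition dx :: "(complex \<Rightarrow> complex) \<Rightarrow> complex \<Rightarrow> complex" where
  "dx f z = vector_derivative (\<lambda>s::real. f (z + of_real s)) (at 0)"
definition dy :: "(complex \<Rightarrow> complex) \<Rightarrow> complex \<Rightarrow> complex" where
  "dy f z = vector_derivative (\<lambda>s::real. f (z + \<i> * of_real s)) (at 0)"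
definition dz :: "(complex \<Rightarrow> complex) \<Rightarrow> complex \<Rightarrow> complex" where
  "dz f z = (dx f z - \<i> * dy f z) / 2"
definition dzbar :: "(complex \<Rightarrow> complex) \<Rightarrow> complex \<Rightarrow> complex" where
  "dzbar f z = (dx f z + \<i> * dy f z) / 2"

definition C1_on :: "complex set \<Rightarrow> (complex \<Rightarrow> complex) \<Rightarrow> bool" where
  "C1_on S f \<longleftrightarrow> (\<forall>z\<in>S. f differentiable (at z)) \<and> continuous_on S (dx f) \<and> continuous_on S (dy f)"
definition C2_on :: "complex set \<Rightarrow> (complex \<Rightarrow> complex) \<Rightarrow> bool" where
  "C2_on S f \<longleftrightarrow> C1_on S f \<and> C1_on S (dx f) \<and> C1_on S (dy f)"

definition Delta :: "complex \<Rightarrow> (complex \<Rightarrow> complex) \<Rightarrow> complex \<Rightarrow> complex" where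
  "Delta p f z = - 4 * of_real ((Im z)\<^sup>2) * dz (dzbar f) z + 2 * \<i> * p * of_real (Im z) * dzbar f z"

definition harm_space :: "mat2 set \<Rightarrow> complex \<Rightarrow> (mat2 \<Rightarrow> complex) \<Rightarrow> (complex \<Rightarrow> complex) set" where
  "harm_space G r v = {H. C2_on upper H \<and> (\<forall>z\<in>upper. Delta (2 - cnj r) H z = 0) \<and>
     (\<forall>g\<in>G. \<forall>z\<in>upper. inverse (cnj (v g)) * cfac g z powr (cnj r - 2) * H (moeb g z) = H z)}"

end

theory Submission
  imports Defs
begin

text \<open>The non-holomorphic Eichler integral
  \<open>\<Phi>(t) = \<integral> (z - t)^(r-2) F(z) dz\<close> from \<open>z0\<close> to \<open>cnj t\<close> on the lower half-plane satisfies
  \<open>\<Phi>|(g - 1) = \<psi>_g\<close> and \<open>\<partial>_tbar \<Phi> = (cnj t - t)^(r-2) F(cnj t)\<close>. Hence the class becomes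
  trivial exactly if \<open>\<Phi> = \<phi> + Q\<close> with \<open>\<phi>\<close> holomorphic and \<open>Q\<close> invariant. Reflecting, such \<open>Q\<close>
  correspond, up to the constant \<open>2 i (2 i)^(r-2)\<close>, to the invariant functions
  \<open>H(z) = cnj (Q (cnj z))\<close> with prescribed \<open>\<partial>_zbar H\<close>, and the shape of \<open>\<partial>_zbar H\<close> already
  forces harmonicity.\<close>

lemma upper_iff [simp]: "z \<in> upper \<longleftrightarrow> Im z > 0"
  by (simp add: upper_def)

lemma lower_iff [simp]: "z \<in> lower \<longleftrightarrow> Im z < 0"
  by (simp add: lower_def)

lemma open_upper: "open upper" and convex_upper: "convex upper"
  unfolding upper_def by (rule open_halfspace_Im_gt convex_halfspace_Im_gt)+

lemma open_lower: "open lower" and convex_lower: "convex lower"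
  unfolding lower_def by (rule open_halfspace_Im_lt convex_halfspace_Im_lt)+

subsection \<open>Wirtinger derivatives\<close>

text \<open>The real differential is split into its complex-linear and antilinear parts. All
  calculus rules are thus inherited from \<open>has_derivative\<close>, and \<open>b = 0\<close> is
  exactly complex differentiability.\<close>

definition has_wirtinger :: "(complex \<Rightarrow> complex) \<Rightarrow> complex \<Rightarrow> complex \<Rightarrow> complex \<Rightarrow> bool" where
  "has_wirtinger f a b z \<longleftrightarrow> (f has_derivative (\<lambda>k. a * k + b * cnj k)) (at z)"

lemma has_wirtinger_dx_dy:
  assumes "has_wirtinger f a b z"
  shows "dx f z = a + b" and "dy f z = \<i> * (a - b)"
proof -
  \<comment> \<open>The summand \<open>c * of_real 0\<close> makes the base point literally the
    value at 0 of the line along which \<open>f\<close> is restricted; \<open>c = 1\<close> and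
    \<open>c = \<i>\<close> give the two partial derivatives.\<close>
  have f: "(f has_derivative (\<lambda>k. a * k + b * cnj k)) (at (z + c * of_real 0))" for c
    using assms by (simp add: has_wirtinger_def)
  have *: "((\<lambda>s::real. f (z + c * of_real s)) has_vector_derivative (a * c + b * cnj c)) (at 0)" for c
  proof -
    have "((\<lambda>s::real. z + c * of_real s) has_derivative (\<lambda>s. c * of_real s)) (at 0)"
      by (auto intro!: derivative_eq_intros)
    from diff_chain_at[OF this f] show ?thesis
      by (simp add: o_def has_vector_derivative_def scaleR_conv_of_real algebra_simps)
  qed
  show "dx f z = a + b"
    using *[of 1] by (simp add: dx_def vector_derivative_at)
  show "dy f z = \<i> * (a - b)"
    using *[of \<i>] by (simp add: dy_def vector_derivative_at algebra_simps)
qed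

lemma has_wirtinger_dz_dzbar:
  assumes "has_wirtinger f a b z"
  shows "dz f z = a" and "dzbar f z = b"
  by (simp_all add: dz_def dzbar_def has_wirtinger_dx_dy[OF assms] algebra_simps)

text \<open>A real-linear map \<open>D\<close> of the plane is determined by \<open>D 1\<close> and
  \<open>D \<i>\<close>, and these two values yield its linear and antilinear coefficients. The
  previous lemma then identifies them with \<open>dz\<close> and \<open>dzbar\<close>.\<close>

lemma differentiable_has_wirtinger:
  assumes "f differentiable (at z)"
  shows "has_wirtinger f (dz f z) (dzbar f z) z"
proof -
  obtain D where D: "(f has_derivative D) (at z)"
    using assms by (auto simp: differentiable_def)
  interpret D: bounded_linear D using D by (rule has_derivative_bounded_linear)
  have "D k = ((D 1 - \<i> * D \<i>) / 2) * k + ((D 1 + \<i> * D \<i>) / 2) * cnj k" for k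
  proof -
    have "D k = D (Re k *\<^sub>R 1 + Im k *\<^sub>R \<i>)"
      by (rule arg_cong[of _ _ D]) (simp add: complex_eq_iff)
    also have "\<dots> = of_real (Re k) * D 1 + of_real (Im k) * D \<i>"
      unfolding D.add D.scaleR by (simp add: scaleR_conv_of_real)
    also have "\<dots> = ((D 1 - \<i> * D \<i>) / 2) * k + ((D 1 + \<i> * D \<i>) / 2) * cnj k"
      by (simp add: complex_eq_iff field_simps)
    finally show ?thesis .
  qed
  hence "has_wirtinger f ((D 1 - \<i> * D \<i>) / 2) ((D 1 + \<i> * D \<i>) / 2) z"
    using D unfolding has_wirtinger_def by (metis (no_types, lifting) ext)
  with has_wirtinger_dz_dzbar[OF this] show ?thesis by metis
qed

lemma has_wirtinger_transform:
  assumes "has_wirtinger f a b z" "open S" "z \<in> S" "\<And>x. x \<in> S \<Longrightarrow> f x = g x"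
  shows "has_wirtinger g a b z"
  using assms has_derivative_transform_within_open unfolding has_wirtinger_def by blast

lemma has_wirtinger_add:
  "has_wirtinger f a b z \<Longrightarrow> has_wirtinger g a' b' z \<Longrightarrow>
    has_wirtinger (\<lambda>z. f z + g z) (a + a') (b + b') z"
  unfolding has_wirtinger_def by (drule (1) has_derivative_add) (simp add: algebra_simps)

lemma has_wirtinger_diff:
  "has_wirtinger f a b z \<Longrightarrow> has_wirtinger g a' b' z \<Longrightarrow>
    has_wirtinger (\<lambda>z. f z - g z) (a - a') (b - b') z"
  unfolding has_wirtinger_def by (drule (1) has_derivative_diff) (simp add: algebra_simps)

lemma has_wirtinger_mult:
  "has_wirtinger f a b z \<Longrightarrow> has_wirtinger g a' b' z \<Longrightarrow>
    has_wirtinger (\<lambda>z. f z * g z) (a * g z + f z * a') (b * g z + f z * b') z"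
  unfolding has_wirtinger_def by (drule (1) has_derivative_mult) (simp add: algebra_simps)

lemma has_wirtinger_const: "has_wirtinger (\<lambda>z. c) 0 0 z"
  unfolding has_wirtinger_def by simp

lemma has_wirtinger_cmult:
  "has_wirtinger f a b z \<Longrightarrow> has_wirtinger (\<lambda>z. c * f z) (c * a) (c * b) z"
  using has_wirtinger_mult[OF has_wirtinger_const] by fastforce

lemma has_wirtinger_holomorphic:
  "(f has_field_derivative f') (at z) \<Longrightarrow> has_wirtinger f f' 0 z"
  by (simp add: has_wirtinger_def has_field_derivative_def)

lemma has_field_derivative_wirtinger:
  "has_wirtinger f a 0 z \<Longrightarrow> (f has_field_derivative a) (at z)"
  by (simp add: has_wirtinger_def has_field_derivative_def)

lemma has_wirtinger_cnj:
  assumes "has_wirtinger f a b z"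
  shows "has_wirtinger (\<lambda>z. cnj (f z)) (cnj b) (cnj a) z"
  using bounded_linear.has_derivative[OF bounded_linear_cnj assms[unfolded has_wirtinger_def]]
  by (simp add: has_wirtinger_def add.commute)

lemma has_wirtinger_compose_cnj:
  assumes "has_wirtinger f a b (cnj z)"
  shows "has_wirtinger (\<lambda>z. f (cnj z)) b a z"
proof -
  have "(cnj has_derivative cnj) (at z)"
    using bounded_linear_cnj by (rule bounded_linear_imp_has_derivative)
  from diff_chain_at[OF this assms[unfolded has_wirtinger_def]] show ?thesis
    by (simp add: has_wirtinger_def o_def add.commute)
qed

lemma has_wirtinger_imp_isCont: "has_wirtinger f a b z \<Longrightarrow> isCont f z"
  unfolding has_wirtinger_def by (rule has_derivative_continuous)

lemma has_wirtinger_continuous_on: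
  assumes "\<And>z. z \<in> S \<Longrightarrow> has_wirtinger f (a z) (b z) z"
  shows "continuous_on S f"
  using assms has_wirtinger_imp_isCont continuous_at_imp_continuous_on by blast

section \<open>Smoothness criteria in terms of Wirtinger coefficients\<close>

lemma C1_onI:
  assumes "\<And>z. z \<in> S \<Longrightarrow> has_wirtinger f (a z) (b z) z"
    and "continuous_on S a" "continuous_on S b"
  shows "C1_on S f"
proof -
  have "f differentiable (at z)" if "z \<in> S" for z
    using assms(1)[OF that] unfolding has_wirtinger_def differentiable_def by blast
  moreover have "continuous_on S (dx f) \<longleftrightarrow> continuous_on S (\<lambda>z. a z + b z)"
    using assms(1) by (intro continuous_on_cong) (auto simp: has_wirtinger_dx_dy)
  moreover have "continuous_on S (dy f) \<longleftrightarrow> continuous_on S (\<lambda>z. \<i> * (a z - b z))"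
    using assms(1) by (intro continuous_on_cong) (auto simp: has_wirtinger_dx_dy)
  ultimately show ?thesis
    using assms(2,3) unfolding C1_on_def by (auto intro!: continuous_intros)
qed

text \<open>On the open set \<open>S\<close> the partials are \<open>a + b\<close> and
  \<open>\<i> * (a - b)\<close>, so derivatives of the coefficients transfer to \<open>dx f\<close>
  and \<open>dy f\<close>.\<close>

lemma C2_onI:
  assumes S: "open S"
    and f: "\<And>z. z \<in> S \<Longrightarrow> has_wirtinger f (a z) (b z) z"
    and a: "\<And>z. z \<in> S \<Longrightarrow> has_wirtinger a (a1 z) (a2 z) z"
    and b: "\<And>z. z \<in> S \<Longrightarrow> has_wirtinger b (b1 z) (b2 z) z"
    and [continuous_intros]: "continuous_on S a1" "continuous_on S a2" "continuous_on S b1" "continuous_on S b2"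
  shows "C2_on S f"
  unfolding C2_on_def
proof (intro conjI)
  show "C1_on S f"
    using f has_wirtinger_continuous_on[OF a] has_wirtinger_continuous_on[OF b] by (rule C1_onI)
  have "has_wirtinger (dx f) (a1 z + b1 z) (a2 z + b2 z) z" if "z \<in> S" for z
    using has_wirtinger_add[OF a b, OF that that] S that
    by (rule has_wirtinger_transform) (simp add: has_wirtinger_dx_dy[OF f])
  then show "C1_on S (dx f)"
    by (rule C1_onI) (auto intro!: continuous_intros)
  have "has_wirtinger (dy f) (\<i> * (a1 z - b1 z)) (\<i> * (a2 z - b2 z)) z" if "z \<in> S" for z
    using has_wirtinger_cmult[OF has_wirtinger_diff[OF a b, OF that that]] S that
    by (rule has_wirtinger_transform) (simp add: has_wirtinger_dx_dy[OF f])
  then show "C1_on S (dy f)"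
    by (rule C1_onI) (auto intro!: continuous_intros)
qed

text \<open>The function is a holomorphic power near the positive axis composed with
  \<open>Im z = (z - cnj z) / (2 * \<i>)\<close>; the two terms of this quotient give coefficients
  of opposite sign.\<close>

lemma has_wirtinger_Im_powr:
  assumes "Im z > 0"
  shows "has_wirtinger (\<lambda>z. of_real (Im z) powr p)
    (p / (2 * \<i>) * of_real (Im z) powr (p - 1)) (- p / (2 * \<i>) * of_real (Im z) powr (p - 1)) z"
proof -
  have "((\<lambda>z. of_real (Im z)) has_derivative (\<lambda>k. of_real (Im k) :: complex)) (at z)"
    by (intro bounded_linear_imp_has_derivative bounded_linear_compose[OF bounded_linear_of_real bounded_linear_Im])
  moreover have "((\<lambda>w. w powr p) has_derivative (\<lambda>k. p * of_real (Im z) powr (p - 1) * k))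
      (at (complex_of_real (Im z)))"
    using assms has_field_derivative_powr[of "complex_of_real (Im z)" p]
    by (simp add: has_field_derivative_def complex_nonpos_Reals_iff)
  ultimately have "((\<lambda>w. w powr p) \<circ> (\<lambda>z. of_real (Im z)) has_derivative
      (\<lambda>k. p * of_real (Im z) powr (p - 1) * k) \<circ> (\<lambda>k. of_real (Im k))) (at z)"
    by (rule diff_chain_at)
  moreover have "(\<lambda>k. p * of_real (Im z) powr (p - 1) * k) \<circ> (\<lambda>k. of_real (Im k))
    = (\<lambda>k. p / (2 * \<i>) * of_real (Im z) powr (p - 1) * k + - p / (2 * \<i>) * of_real (Im z) powr (p - 1) * cnj k)"
  proof
    fix k
    have im: "complex_of_real (Im k) = (k - cnj k) / (2 * \<i>)"
      by (simp add: complex_eq_iff)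
    show "((\<lambda>k. p * of_real (Im z) powr (p - 1) * k) \<circ> (\<lambda>k. of_real (Im k))) k
      = p / (2 * \<i>) * of_real (Im z) powr (p - 1) * k + - p / (2 * \<i>) * of_real (Im z) powr (p - 1) * cnj k"
      unfolding o_def im by (simp add: field_simps)
  qed
  ultimately show ?thesis
    by (simp only: has_wirtinger_def o_def)
qed

subsection \<open>Eichler integrals\<close>

text \<open>Branch point \<open>t\<close> and endpoint \<open>w\<close> are independent: fixed
  \<open>w\<close> gives the cocycle, \<open>w = cnj t\<close> the non-holomorphic integral. The
  exponent is free because differentiation in \<open>t\<close> lowers it by one.\<close>

definition eichler :: "complex \<Rightarrow> (complex \<Rightarrow> complex) \<Rightarrow> complex \<Rightarrow> complex \<Rightarrow> complex \<Rightarrow> complex" where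
  "eichler s F a t w = contour_integral (linepath a w) (\<lambda>z. (z - t) powr s * F z)"

text \<open>Here \<open>z - t\<close> lies in the upper half-plane, off the cut; its argument is in
  (0, pi), so the principal branch agrees with the range (-pi/2, 3pi/2).\<close>

lemma powr_diff_holomorphic:
  assumes "Im t < 0"
  shows "(\<lambda>z. (z - t) powr s) holomorphic_on upper"
  using assms by (intro holomorphic_intros) (auto simp: complex_nonpos_Reals_iff)

text \<open>For fixed \<open>t\<close>, convexity of the upper half-plane gives a global primitive,
  so changing base points or endpoints becomes subtraction of values.\<close>

lemma eichler_primitive:
  assumes "F holomorphic_on upper" "Im t < 0"
  obtains P where
    "\<And>w. Im w > 0 \<Longrightarrow> (P has_field_derivative (w - t) powr s * F w) (at w)"
    "\<And>a w. Im a > 0 \<Longrightarrow> Im w > 0 \<Longrightarrow> eichler s F a t w = P w - P a"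
proof -
  have "(\<lambda>z. (z - t) powr s * F z) holomorphic_on upper"
    by (intro holomorphic_on_mult powr_diff_holomorphic assms)
  from holomorphic_convex_primitive'[OF convex_upper open_upper this]
  obtain P where P: "\<And>w. w \<in> upper \<Longrightarrow> (P has_field_derivative (w - t) powr s * F w) (at w within upper)"
    by blast
  show ?thesis
  proof
    show "(P has_field_derivative (w - t) powr s * F w) (at w)" if "Im w > 0" for w
      using P[of w] that by (simp add: at_within_open[OF _ open_upper])
    show "eichler s F a t w = P w - P a" if "Im a > 0" "Im w > 0" for a w
    proof -
      have "path_image (linepath a w) \<subseteq> upper"
        using that closed_segment_subset[OF _ _ convex_upper, of a w] by simp
      from contour_integral_primitive[OF P valid_path_linepath this] show ?thesis
        by (simp add: eichler_def contour_integral_unique)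
    qed
  qed
qed

text \<open>Differentiation under the integral sign: the segment stays above the real axis and
  \<open>t\<close> below it, so the kernel is holomorphic in \<open>t\<close>.\<close>

lemma eichler_has_derivative_pole:
  assumes F: "F holomorphic_on upper" and "Im a > 0" "Im w > 0" "Im t < 0"
  shows "((\<lambda>t. eichler s F a t w) has_field_derivative - s * eichler (s - 1) F a t w) (at t)"
proof -
  have path: "Im (linepath a w u) > 0" if "u \<in> {0..1}" for u
  proof -
    have "linepath a w u \<in> closed_segment a w"
      using that by (metis imageI path_image_def path_image_linepath)
    then show ?thesis
      using assms closed_segment_subset[OF _ _ convex_upper, of a w] by auto
  qed
  have eq: "eichler s F a t w = integral (cbox 0 1) (\<lambda>u. (linepath a w u - t) powr s * F (linepath a w u) * (w - a))" for t s
    by (simp add: eichler_def contour_integral_integral)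
  define c where "c = (\<lambda>(t, u). - s * (linepath a w u - t) powr (s - 1) * F (linepath a w u) * (w - a))"
  have cF: "continuous_on {0..1} (\<lambda>u. F (linepath a w u))"
    using F path by (intro continuous_on_compose2[OF holomorphic_on_imp_continuous_on[OF F]]
        continuous_on_linepath) auto
  have *: "((\<lambda>t. integral (cbox 0 1) (\<lambda>u. (linepath a w u - t) powr s * F (linepath a w u) * (w - a)))
      has_field_derivative integral (cbox 0 1) (\<lambda>u. c (t, u))) (at t within lower)"
  proof (rule leibniz_rule_field_derivative[where fx = "\<lambda>t u. c (t, u)"])
    fix t u assume t: "t \<in> lower" and u: "u \<in> cbox 0 (1::real)"
    have "linepath a w u - t \<notin> \<real>\<^sub>\<le>\<^sub>0"
      using path[of u] t u by (auto simp: complex_nonpos_Reals_iff)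
    then show "((\<lambda>t. (linepath a w u - t) powr s * F (linepath a w u) * (w - a)) has_field_derivative c (t, u))
         (at t within lower)"
      unfolding c_def by (auto intro!: derivative_eq_intros)
  next
    fix t assume t: "t \<in> lower"
    have "Im (linepath a w u) \<noteq> Im t" if "u \<in> {0..1}" for u
      using path[of u] t that by auto
    then have "continuous_on {0..1} (\<lambda>u. (linepath a w u - t) powr s * F (linepath a w u) * (w - a))"
      by (intro continuous_intros continuous_on_powr_complex cF) auto
    then show "(\<lambda>u. (linepath a w u - t) powr s * F (linepath a w u) * (w - a)) integrable_on cbox 0 1"
      by (intro integrable_continuous) simp
  next
    \<comment> \<open>Joint continuity of the \<open>t\<close>-derivative on the product, as the
      Leibniz rule demands; positivity of this imaginary part keeps the base of the power off the
      cut.\<close>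
    have pos: "Im (linepath a w (snd x) - fst x) > 0" if "x \<in> lower \<times> {0..1}" for x
      using path[of "snd x"] that by (auto simp: mem_Times_iff)
    have path_cont: "continuous_on (lower \<times> {0..1}) (\<lambda>x. linepath a w (snd x))"
      unfolding linepath_def by (intro continuous_intros)
    have F_cont: "continuous_on (lower \<times> {0..1}) (\<lambda>x. F (linepath a w (snd x)))"
      by (rule continuous_on_compose2[OF cF continuous_on_snd]) auto
    have powr_cont: "continuous_on (lower \<times> {0..1}) (\<lambda>x. (linepath a w (snd x) - fst x) powr (s - 1))"
    proof (rule continuous_on_powr_complex)
      show "lower \<times> {0..1} \<subseteq> {x. 0 \<le> Re (linepath a w (snd x) - fst x) \<or> Im (linepath a w (snd x) - fst x) \<noteq> 0}"
        using pos less_irrefl by (metis (mono_tags, lifting) mem_Collect_eq subsetI)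
      show "0 < Re (s - 1)" if "x \<in> lower \<times> {0..1}" "linepath a w (snd x) - fst x = 0" for x
        using pos[OF that(1)] that(2) by simp
    qed (intro continuous_on_diff path_cont continuous_on_fst continuous_on_id continuous_on_const)+
    have "continuous_on (lower \<times> {0..1})
       (\<lambda>x. - s * (linepath a w (snd x) - fst x) powr (s - 1) * F (linepath a w (snd x)) * (w - a))"
      by (intro continuous_on_mult continuous_on_const powr_cont F_cont)
    then show "continuous_on (lower \<times> cbox 0 1) (\<lambda>(t, u). c (t, u))"
      by (simp add: c_def split_beta)
  qed (use assms convex_lower in auto)
  have c: "integral (cbox 0 1) (\<lambda>u. c (t, u)) = - s * eichler (s - 1) F a t w"
    unfolding eq c_def by (simp add: mult.assoc flip: integral_mult_right)
  show ?thesis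
    using * assms unfolding c eq[symmetric] by (simp add: at_within_open[OF _ open_lower])
qed

text \<open>The first coefficient is again an Eichler integral, of exponent \<open>s - 1\<close>, so that higher
  derivatives follow by iteration.\<close>
lemma eichler_cnj_has_wirtinger:
  assumes F: "F holomorphic_on upper" and a: "Im a > 0" and t: "Im t < 0"
  shows "has_wirtinger (\<lambda>t. eichler s F a t (cnj t))
     (- s * eichler (s - 1) F a t (cnj t)) ((cnj t - t) powr s * F (cnj t)) t"
proof -
  define fy where "fy = (\<lambda>t w. blinfun_mult_right ((w - t) powr s * F w))"
  have "((\<lambda>(t, w). eichler s F a t w) has_derivative
     (\<lambda>(h, k). - s * eichler (s - 1) F a t (cnj t) * h + fy t (cnj t) k)) (at (t, cnj t) within lower \<times> upper)"
  proof (rule has_derivative_partialsI)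
    show "((\<lambda>x. eichler s F a x (cnj t)) has_derivative (\<lambda>h. - s * eichler (s - 1) F a t (cnj t) * h)) (at t within lower)"
      by (rule has_derivative_at_withinI, rule eichler_has_derivative_pole[OF F a _ t, unfolded has_field_derivative_def])
         (use t in simp)
  next
    fix t w assume tw: "t \<in> lower" "w \<in> upper"
    then have t: "Im t < 0" by simp
    obtain P where P: "\<And>w. Im w > 0 \<Longrightarrow> (P has_field_derivative (w - t) powr s * F w) (at w)"
      "\<And>a w. Im a > 0 \<Longrightarrow> Im w > 0 \<Longrightarrow> eichler s F a t w = P w - P a"
      using eichler_primitive[OF F t] by blast
    have "((\<lambda>w. P w - P a) has_field_derivative (w - t) powr s * F w) (at w)"
      using P(1)[of w] tw by (auto intro!: derivative_eq_intros)
    then have "((\<lambda>w. eichler s F a t w) has_field_derivative (w - t) powr s * F w) (at w)"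
      by (rule has_field_derivative_transform_within_open[OF _ open_upper]) (use tw a P in auto)
    then show "((\<lambda>w. eichler s F a t w) has_derivative fy t w) (at w within upper)"
      by (auto simp: has_field_derivative_def fy_def intro: has_derivative_at_withinI)
  next
    have "continuous_on (lower \<times> upper) (\<lambda>x. fy (fst x) (snd x))"
      unfolding fy_def
      by (intro continuous_intros continuous_on_powr_complex
          continuous_on_compose2[OF holomorphic_on_imp_continuous_on[OF F]]
          bounded_linear.continuous_on[OF bounded_linear_blinfun_mult_right])
         (auto simp: complex_nonpos_Reals_iff)
    then show "continuous (at (t, cnj t) within lower \<times> upper) (\<lambda>(x, y). fy x y)"
      using t unfolding case_prod_unfold continuous_on_eq_continuous_within by simp
  qed (use t convex_upper in auto)
  moreover have "at (t, cnj t) within lower \<times> upper = at (t, cnj t)"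
    using t by (intro at_within_open open_Times open_lower open_upper) auto
  ultimately have "((\<lambda>(t, w). eichler s F a t w) has_derivative
     (\<lambda>(h, k). - s * eichler (s - 1) F a t (cnj t) * h + fy t (cnj t) k)) (at (t, cnj t))"
    by simp
  \<comment> \<open>Along \<open>t \<mapsto> (t, cnj t)\<close> the partial in the branch point
    becomes the linear coefficient and the partial in the endpoint the antilinear one.\<close>
  moreover have "((\<lambda>t. (t, cnj t)) has_derivative (\<lambda>h. (h, cnj h))) (at t)"
    by (intro has_derivative_Pair bounded_linear_imp_has_derivative bounded_linear_cnj has_derivative_ident)
  ultimately show ?thesis
    using diff_chain_at[of "\<lambda>t. (t, cnj t)"] by (fastforce simp: has_wirtinger_def o_def fy_def)
qed

subsection \<open>Moebius transformations and branches of powers\<close>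

lemma cnj_cfac: "cnj (cfac g z) = cfac g (cnj z)"
  by (simp add: cfac_def)

lemma cnj_moeb: "cnj (moeb g z) = moeb g (cnj z)"
  by (simp add: moeb_def)

lemma det_mat2: "det g = mat_a g * mat_d g - mat_b g * mat_c g"
  by (simp add: det_2 mat_a_def mat_b_def mat_c_def mat_d_def)

lemma cfac_nonzero:
  assumes "det g = 1" "Im z \<noteq> 0"
  shows "cfac g z \<noteq> 0"
proof
  assume 0: "cfac g z = 0"
  then have "mat_c g * Im z = 0"
    by (simp add: cfac_def complex_eq_iff)
  with assms have c: "mat_c g = 0" by simp
  with 0 have "mat_d g = 0"
    by (simp add: cfac_def)
  with c assms(1) show False by (simp add: det_mat2)
qed

lemma moeb_mult:
  assumes "cfac h z \<noteq> 0"
  shows "moeb (g ** h) z = moeb g (moeb h z)"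
proof -
  define n where "n = of_real (mat_a h) * z + of_real (mat_b h)"
  have "moeb g (moeb h z) = moeb g (n / cfac h z)"
    by (simp add: moeb_def n_def cfac_def)
  also have "\<dots> = ((of_real (mat_a g) * n + of_real (mat_b g) * cfac h z) / cfac h z) /
      ((of_real (mat_c g) * n + of_real (mat_d g) * cfac h z) / cfac h z)"
    using assms by (simp add: moeb_def add_divide_distrib)
  also have "\<dots> = (of_real (mat_a g) * n + of_real (mat_b g) * cfac h z) /
      (of_real (mat_c g) * n + of_real (mat_d g) * cfac h z)"
    using assms by simp
  also have "\<dots> = moeb (g ** h) z"
    by (simp add: moeb_def n_def cfac_def matrix_matrix_mult_def sum_2
        mat_a_def mat_b_def mat_c_def mat_d_def algebra_simps)
  finally show ?thesis ..
qed

text \<open>Over the common denominator the numerator collapses to \<open>det g * (w - t)\<close>.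
  The case \<open>t = cnj w\<close> gives the formula for imaginary parts; the general case governs
  the kernel of the integral.\<close>

lemma moeb_diff:
  assumes "det g = 1" "cfac g w \<noteq> 0" "cfac g t \<noteq> 0"
  shows "moeb g w - moeb g t = (w - t) / (cfac g w * cfac g t)"
proof -
  have "complex_of_real (mat_a g * mat_d g - mat_b g * mat_c g) = 1"
    using assms(1) by (simp add: det_mat2)
  then have "complex_of_real (mat_a g) * of_real (mat_d g) = 1 + of_real (mat_b g) * of_real (mat_c g)"
    by (simp add: algebra_simps)
  then have "(of_real (mat_a g) * w + of_real (mat_b g)) * cfac g t -
      (of_real (mat_a g) * t + of_real (mat_b g)) * cfac g w = w - t"
    unfolding cfac_def by algebra
  then show ?thesis
    using assms(2,3) by (simp add: moeb_def flip: cfac_def) (simp add: field_simps)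
qed

lemma Im_moeb:
  assumes "det g = 1" "Im z \<noteq> 0"
  shows "Im (moeb g z) = Im z / (cmod (cfac g z))\<^sup>2"
proof -
  have "cfac g z \<noteq> 0" "cfac g (cnj z) \<noteq> 0"
    using assms by (simp_all add: cfac_nonzero)
  then have "moeb g z - cnj (moeb g z) = (z - cnj z) / (cfac g z * cnj (cfac g z))"
    using moeb_diff[OF assms(1)] by (simp add: cnj_moeb cnj_cfac)
  then have "complex_of_real (2 * Im (moeb g z)) * \<i> = of_real (2 * Im z / (cmod (cfac g z))\<^sup>2) * \<i>"
    by (simp add: complex_diff_cnj complex_norm_square[symmetric])
  then have "2 * Im (moeb g z) = 2 * Im z / (cmod (cfac g z))\<^sup>2"
    by (simp only: mult_cancel_right complex_i_not_zero of_real_eq_iff simp_thms)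
  then show ?thesis by simp
qed

lemma Im_moeb_pos: "det g = 1 \<Longrightarrow> Im z > 0 \<Longrightarrow> Im (moeb g z) > 0"
  and Im_moeb_neg: "det g = 1 \<Longrightarrow> Im z < 0 \<Longrightarrow> Im (moeb g z) < 0"
  using cfac_nonzero[of g z] by (simp_all add: Im_moeb divide_neg_pos)

lemma moeb_has_field_derivative:
  assumes "det g = 1" "cfac g z \<noteq> 0"
  shows "(moeb g has_field_derivative inverse ((cfac g z)\<^sup>2)) (at z)"
proof -
  have "complex_of_real (mat_a g * mat_d g - mat_b g * mat_c g) = 1"
    using assms(1) by (simp add: det_mat2)
  then have 1: "complex_of_real (mat_a g) * of_real (mat_d g) = 1 + of_real (mat_b g) * of_real (mat_c g)"
    by (simp add: algebra_simps)
  have "(moeb g has_field_derivative ((of_real (mat_a g) * cfac g z -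
      (of_real (mat_a g) * z + of_real (mat_b g)) * of_real (mat_c g)) / (cfac g z * cfac g z))) (at z)"
    using assms(2) unfolding moeb_def[abs_def] cfac_def by (auto intro!: derivative_eq_intros)
  moreover have "of_real (mat_a g) * cfac g z -
      (of_real (mat_a g) * z + of_real (mat_b g)) * of_real (mat_c g) = 1"
    unfolding cfac_def using 1 by algebra
  ultimately show ?thesis by (simp add: inverse_eq_divide power2_eq_square)
qed

text \<open>Conjugation exchanges the argument ranges (-pi, pi] and [-pi, pi), so one logarithm
  covers both cases of \<open>powL\<close>. At 0 the formula fails, since \<open>powr\<close>
  vanishes there.\<close>

lemma powL_eq:
  assumes "w \<noteq> 0"
  shows "powL w s = exp (s * cnj (Ln (cnj w)))"
proof (cases "Im w = 0 \<and> Re w < 0")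
  case True
  then have w: "w = - of_real (- Re w)"
    by (simp add: complex_eq_iff)
  have "Ln (cnj w) = of_real (ln (- Re w)) + \<i> * of_real pi"
    using True Ln_minus[of "of_real (- Re w)"] Ln_of_real[of "- Re w"] by (subst w) simp
  with True show ?thesis by (simp add: powL_def)
next
  case False
  then have "w \<notin> \<real>\<^sub>\<le>\<^sub>0"
    using assms by (auto simp: complex_nonpos_Reals_iff complex_eq_iff)
  then have "cnj (Ln (cnj w)) = Ln w"
    using cnj_Ln[of w] by (metis complex_cnj_cnj)
  with False assms show ?thesis by (auto simp: powL_def powr_def)
qed

text \<open>The bridge from the branch convention on the lower half-plane to the principal branch on
  the upper one.\<close>

lemma cnj_powL: "w \<noteq> 0 \<Longrightarrow> cnj (powL w s) = cnj w powr cnj s"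
  by (simp add: powL_eq powr_def exp_cnj)

lemma powL_nonzero: "w \<noteq> 0 \<Longrightarrow> powL w s \<noteq> 0"
  by (simp add: powL_eq)

lemma powL_minus: "w \<noteq> 0 \<Longrightarrow> powL w (- s) = inverse (powL w s)"
  by (simp add: powL_eq exp_minus)

text \<open>The arguments of \<open>cfac g w\<close> and of the conjugate of \<open>cfac g t\<close> have the same sign, so both
  sides have imaginary parts differing by less than \<open>2 \<pi>\<close>; the logarithm of \<open>cfac g t\<close> with argument
  in \<open>[-\<pi>, \<pi>)\<close>, underlying \<^const>\<open>powL\<close>, is \<open>cnj (Ln (cnj (cfac g t)))\<close>.\<close>
lemma Ln_moeb_diff:
  assumes g: "det g = 1" and w: "Im w > 0" and t: "Im t < 0"
  shows "Ln (moeb g w - moeb g t) = Ln (w - t) - Ln (cfac g w) - cnj (Ln (cnj (cfac g t)))"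
proof (rule exp_complex_eqI)
  have real_bound: "\<bar>y - (x - a - (- b))\<bar> < 2 * p"
    if "\<bar>a - b\<bar> < p" "0 < x" "x < p" "0 < y" "y < p" for a b x y p :: real
    using that by linarith
  have nz: "cfac g w \<noteq> 0" "cfac g t \<noteq> 0" "w - t \<noteq> 0" "moeb g w - moeb g t \<noteq> 0"
    using cfac_nonzero[OF g] w t Im_moeb_pos[OF g w] Im_moeb_neg[OF g t] by auto
  show "exp (Ln (moeb g w - moeb g t)) = exp (Ln (w - t) - Ln (cfac g w) - cnj (Ln (cnj (cfac g t))))"
    using nz moeb_diff[OF g nz(1,2)] by (simp add: exp_diff flip: exp_cnj)
  have "\<bar>Im (Ln (cfac g w)) - Im (Ln (cnj (cfac g t)))\<bar> < pi"
  \<comment> \<open>Both \<open>w\<close> and \<open>cnj t\<close> lie above the real axis, so both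
    imaginary parts have the sign of \<open>mat_c g\<close>. If \<open>mat_c g = 0\<close>, both
    factors equal \<open>mat_d g\<close> and the arguments coincide even for a negative
    value.\<close>
  proof (cases "mat_c g" "0 :: real" rule: linorder_cases)
    case less
    then have "Im (cfac g w) < 0" "Im (cnj (cfac g t)) < 0"
      using w t by (simp_all add: cfac_def mult_neg_pos mult_neg_neg)
    then show ?thesis
      using nz Im_Ln_pos_le[of "cfac g w"] Im_Ln_pos_le[of "cnj (cfac g t)"]
        mpi_less_Im_Ln[of "cfac g w"] mpi_less_Im_Ln[of "cnj (cfac g t)"]
        Im_Ln_le_pi[of "cfac g w"] Im_Ln_le_pi[of "cnj (cfac g t)"]
      by (simp add: abs_less_iff)
  next
    case equal
    then show ?thesis by (simp add: cfac_def)
  next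
    case greater
    then have "Im (cfac g w) > 0" "Im (cnj (cfac g t)) > 0"
      using w t by (simp_all add: cfac_def mult_pos_neg)
    then show ?thesis
      using nz Im_Ln_pos_lt[of "cfac g w"] Im_Ln_pos_lt[of "cnj (cfac g t)"] by auto
  qed
  moreover have "0 < Im (Ln (w - t))" "Im (Ln (w - t)) < pi"
    using Im_Ln_pos_lt[of "w - t"] nz w t by auto
  moreover have "0 < Im (Ln (moeb g w - moeb g t))" "Im (Ln (moeb g w - moeb g t)) < pi"
    using Im_Ln_pos_lt[of "moeb g w - moeb g t"] nz Im_moeb_pos[OF g w] Im_moeb_neg[OF g t] by auto
  ultimately show "\<bar>Im (Ln (moeb g w - moeb g t)) -
      Im (Ln (w - t) - Ln (cfac g w) - cnj (Ln (cnj (cfac g t))))\<bar> < 2 * pi"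
    unfolding minus_complex.sel cnj.sel by (rule real_bound)
qed

text \<open>Exponentiates the identity of logarithms. The product formula for the bases alone would
  leave the branch of the power undetermined.\<close>

lemma moeb_diff_powr:
  assumes g: "det g = 1" and w: "Im w > 0" and t: "Im t < 0"
  shows "(moeb g w - moeb g t) powr s = (w - t) powr s * cfac g w powr (- s) * powL (cfac g t) (- s)"
proof -
  have nz: "cfac g w \<noteq> 0" "cfac g t \<noteq> 0" "w \<noteq> t" "moeb g w \<noteq> moeb g t"
    using cfac_nonzero[OF g] w t Im_moeb_pos[OF g w] Im_moeb_neg[OF g t] by auto
  have "s * (A - B - C) = s * A + - s * B + - s * C" for A B C :: complex
    by (simp add: algebra_simps)
  with nz show ?thesis
    by (simp only: powr_def powL_eq[OF nz(2)] Ln_moeb_diff[OF assms] exp_add if_False right_minus_eq)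
qed

section \<open>Equivariance of the Eichler integral\<close>

text \<open>Substituting \<open>moeb g w\<close> moves both endpoints, and the automorphy factors in
  the integration variable cancel. Primitives are compared because the image of a segment need not
  be a segment.\<close>

lemma slash_eichler:
  assumes F: "F holomorphic_on upper"
    and g: "det g = 1" and vg: "v g \<noteq> 0"
    and inv: "\<And>w. Im w > 0 \<Longrightarrow> F (moeb g w) = v g * cfac g w powr r * F w"
    and z1: "Im z1 > 0" and t: "Im t < 0"
  shows "slash_lower v r g (\<lambda>t. eichler (r - 2) F (moeb g z1) t (cnj t)) t = eichler (r - 2) F z1 t (cnj t)"
proof -
  \<comment> \<open>The factors free of the integration variable; the slash action multiplies by
    exactly the inverse of \<open>c\<close>.\<close>
  define c where "c = v g * powL (cfac g t) (2 - r)"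
  have ct: "cfac g t \<noteq> 0" using cfac_nonzero[OF g] t by simp
  obtain P where P: "\<And>w. Im w > 0 \<Longrightarrow> (P has_field_derivative (w - t) powr (r - 2) * F w) (at w)"
    "\<And>a w. Im a > 0 \<Longrightarrow> Im w > 0 \<Longrightarrow> eichler (r - 2) F a t w = P w - P a"
    using eichler_primitive[OF F t] by blast
  obtain Q where Q: "\<And>w. Im w > 0 \<Longrightarrow> (Q has_field_derivative (w - moeb g t) powr (r - 2) * F w) (at w)"
    "\<And>a w. Im a > 0 \<Longrightarrow> Im w > 0 \<Longrightarrow> eichler (r - 2) F a (moeb g t) w = Q w - Q a"
    using eichler_primitive[OF F Im_moeb_neg[OF g t]] by blast
  have "((\<lambda>w. Q (moeb g w) - c * P w) has_field_derivative 0) (at w within upper)" if "w \<in> upper" for w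
  proof -
    from that have w: "Im w > 0" by simp
    have cw: "cfac g w \<noteq> 0" using cfac_nonzero[OF g] w by simp
    \<comment> \<open>Powers of \<open>cfac g w\<close>: the kernel contributes
      \<open>2 - r\<close>, \<open>F\<close> contributes \<open>r\<close>, and the derivative of
      \<open>moeb g\<close> contributes -2, in total 0.\<close>
    have "cfac g w powr (- (r - 2)) * cfac g w powr r = cfac g w powr 2"
      by (simp flip: powr_add)
    also have "\<dots> = (cfac g w)\<^sup>2"
      using cw powr_nat'[of "cfac g w" 2] by simp
    finally have pow: "cfac g w powr (- (r - 2)) * cfac g w powr r * inverse ((cfac g w)\<^sup>2) = 1"
      using cw by simp
    have "(moeb g w - moeb g t) powr (r - 2) * F (moeb g w) * inverse ((cfac g w)\<^sup>2)
        = c * ((w - t) powr (r - 2) * F w) *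
          (cfac g w powr (- (r - 2)) * cfac g w powr r * inverse ((cfac g w)\<^sup>2))"
      unfolding moeb_diff_powr[OF g w t] inv[OF w] c_def by (simp only: minus_diff_eq ac_simps)
    then have "(moeb g w - moeb g t) powr (r - 2) * F (moeb g w) * inverse ((cfac g w)\<^sup>2)
        = c * ((w - t) powr (r - 2) * F w)"
      unfolding pow by simp
    moreover have "((\<lambda>w. Q (moeb g w)) has_field_derivative
        (moeb g w - moeb g t) powr (r - 2) * F (moeb g w) * inverse ((cfac g w)\<^sup>2)) (at w)"
      by (rule DERIV_chain2[OF Q(1)[OF Im_moeb_pos[OF g w]] moeb_has_field_derivative[OF g cw]])
    ultimately have "((\<lambda>w. Q (moeb g w) - c * P w) has_field_derivative
        c * ((w - t) powr (r - 2) * F w) - c * ((w - t) powr (r - 2) * F w)) (at w)"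
      by (intro DERIV_diff DERIV_cmult P(1) w) simp
    then show ?thesis
      by (simp add: has_field_derivative_at_within)
  qed
  then obtain k where k: "\<And>w. w \<in> upper \<Longrightarrow> Q (moeb g w) - c * P w = k"
    using has_field_derivative_zero_constant[OF convex_upper, of "\<lambda>w. Q (moeb g w) - c * P w"] by metis
  have "eichler (r - 2) F (moeb g z1) (moeb g t) (cnj (moeb g t)) = Q (moeb g (cnj t)) - Q (moeb g z1)"
    using t Im_moeb_pos[OF g z1] Im_moeb_neg[OF g t] by (subst Q(2)) (auto simp: cnj_moeb[symmetric])
  also have "\<dots> = c * (P (cnj t) - P z1)"
    using k[of "cnj t"] k[of z1] z1 t by (simp add: algebra_simps)
  also have "P (cnj t) - P z1 = eichler (r - 2) F z1 t (cnj t)"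
    using z1 t by (simp add: P(2))
  finally have "slash_lower v r g (\<lambda>t. eichler (r - 2) F (moeb g z1) t (cnj t)) t =
      (inverse (v g) * v g) * (powL (cfac g t) (r - 2) * powL (cfac g t) (2 - r)) * eichler (r - 2) F z1 t (cnj t)"
    by (simp only: slash_lower_def c_def ac_simps)
  then show ?thesis
    using vg powL_nonzero[OF ct, of "r - 2"] powL_minus[OF ct, of "r - 2"] by simp
qed

text \<open>With the base point \<open>z1\<close> equal to the preimage of \<open>z0\<close> under
  \<open>g\<close>, slashing moves the base point from \<open>z0\<close> to that preimage; the
  difference is the integral between the two base points.\<close>

lemma slash_eichler_diff:
  assumes "F holomorphic_on upper" "det g = 1" "v g \<noteq> 0"
    and "\<And>w. Im w > 0 \<Longrightarrow> F (moeb g w) = v g * cfac g w powr r * F w"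
    and "Im (moeb (matrix_inv g) z0) > 0" "moeb g (moeb (matrix_inv g) z0) = z0" "Im z0 > 0" and t: "Im t < 0"
  shows "slash_lower v r g (\<lambda>t. eichler (r - 2) F z0 t (cnj t)) t - eichler (r - 2) F z0 t (cnj t) = psi z0 r F g t"
proof -
  obtain P where P: "\<And>w. Im w > 0 \<Longrightarrow> (P has_field_derivative (w - t) powr (r - 2) * F w) (at w)"
    "\<And>a w. Im a > 0 \<Longrightarrow> Im w > 0 \<Longrightarrow> eichler (r - 2) F a t w = P w - P a"
    using eichler_primitive[OF assms(1) t] by blast
  have "psi z0 r F g t = eichler (r - 2) F (moeb (matrix_inv g) z0) t z0"
    by (simp add: psi_def eichler_def)
  then show ?thesis
    using slash_eichler[of F g v r, OF assms(1-4,5) t] assms(5-8) by (simp add: P(2))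
qed

subsection \<open>Reflection to the upper half-plane\<close>

text \<open>The base is \<open>2 * \<i>\<close> times a positive real, which leaves the argument
  unchanged, so the logarithm splits without correction.\<close>

lemma diff_cnj_powr:
  assumes "Im z > 0"
  shows "(z - cnj z) powr s = (2 * \<i>) powr s * of_real (Im z) powr s"
proof -
  have "z - cnj z = 2 * \<i> * of_real (Im z)"
    by (simp add: complex_eq_iff)
  moreover have "Ln (2 * \<i> * of_real (Im z)) = of_real (ln (Im z)) + Ln (2 * \<i>)"
    using assms by (subst mult.commute, subst Ln_times_of_real) (auto simp: Ln_of_real)
  ultimately show ?thesis
    using assms by (simp add: powr_def Ln_of_real distrib_left mult_exp_exp add.commute)
qed

lemma inverse_moeb:
  assumes "discrete_subgroup_SL2 G" "g \<in> G" "Im z > 0"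
  shows "Im (moeb (matrix_inv g) z) > 0" "moeb g (moeb (matrix_inv g) z) = z"
proof -
  have det: "det g = 1" "det (matrix_inv g) = 1"
    using assms by (auto simp: discrete_subgroup_SL2_def)
  show "Im (moeb (matrix_inv g) z) > 0"
    by (rule Im_moeb_pos[OF det(2) assms(3)])
  have "invertible g"
    using det by (simp add: invertible_det_nz)
  then have "g ** matrix_inv g = mat 1"
    unfolding invertible_def matrix_inv_def by (rule someI2_ex) blast
  then have "moeb g (moeb (matrix_inv g) z) = moeb (mat 1) z"
    using moeb_mult[of "matrix_inv g" z g] cfac_nonzero[OF det(2)] assms(3) by simp
  then show "moeb g (moeb (matrix_inv g) z) = z"
    by (simp add: moeb_def mat_def mat_a_def mat_b_def mat_c_def mat_d_def)
qed

text \<open>Moebius maps with real coefficients commute with conjugation, and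
  \<open>cnj_powL\<close> turns the weight factor of \<open>r\<close> into that of
  \<open>cnj r\<close>.\<close>

lemma harm_space_reflect_iff:
  assumes g: "det g = 1" and t: "Im t < 0"
  shows "slash_lower v r g (\<lambda>t. c * cnj (H (cnj t))) t = c * cnj (H (cnj t)) \<longleftrightarrow>
    c = 0 \<or> inverse (cnj (v g)) * cfac g (cnj t) powr (cnj r - 2) * H (moeb g (cnj t)) = H (cnj t)"
proof -
  have ct: "cfac g t \<noteq> 0" using cfac_nonzero[OF g] t by simp
  have "slash_lower v r g (\<lambda>t. c * cnj (H (cnj t))) t =
      c * cnj (inverse (cnj (v g)) * cfac g (cnj t) powr (cnj r - 2) * H (moeb g (cnj t)))"
    using cnj_powL[OF ct, of "r - 2"] by (simp add: slash_lower_def cnj_moeb cnj_cfac) (metis complex_cnj_cnj)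
  then show ?thesis
    by (simp only: mult_cancel_left complex_cnj_cancel_iff)
qed

text \<open>The derivative \<open>dzbar H\<close> is a constant times \<open>y^(cnj r - 2)\<close>
  times the antiholomorphic \<open>cnj F\<close>. Applying \<open>dz\<close> differentiates only the
  power of \<open>y\<close>, and this cancels against the first-order term of
  \<open>Delta\<close>.\<close>

lemma eichler_reflected_harmonic:
  fixes r :: complex
  assumes F: "F holomorphic_on upper" and a: "Im a > 0" and \<phi>: "\<phi> holomorphic_on lower"
  defines "H \<equiv> \<lambda>z. cnj (inverse (2 * \<i> * (2 * \<i>) powr (r - 2)) *
    (eichler (r - 2) F a (cnj z) z - \<phi> (cnj z)))"
  shows "C2_on upper H"
    and "\<And>z. Im z > 0 \<Longrightarrow> Delta (2 - cnj r) H z = 0"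
    and "\<And>z. Im z > 0 \<Longrightarrow> 2 * \<i> * of_real (Im z) powr (2 - r) * cnj (dzbar H z) = F z"
proof -
  define \<sigma> where "\<sigma> = cnj r - 2"
  define c where "c = cnj (inverse (2 * \<i> * (2 * \<i>) powr (r - 2)))"
  define E where "E = (\<lambda>s z. cnj (eichler s F a (cnj z) z))"
  define \<eta> where "\<eta> = (\<lambda>z. cnj (\<phi> (cnj z)))"
  define Fb where "Fb = (\<lambda>z. cnj (F z))"
  define y where "y = (\<lambda>p z. complex_of_real (Im z) powr p)"
  \<comment> \<open>Composing with \<open>cnj\<close> swaps the coefficients, conjugating the value
    swaps them back and conjugates them; \<open>- 2 * \<i>\<close> arises as
    \<open>cnj (2 * \<i>)\<close>.\<close>
  have E: "has_wirtinger (E s) (cnj (- s) * E (s - 1) z) ((- 2 * \<i>) powr cnj s * y (cnj s) z * Fb z) z"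
    if "Im z > 0" for s z
  proof -
    have "has_wirtinger (\<lambda>t. eichler s F a t (cnj t))
      (- s * eichler (s - 1) F a (cnj z) z) ((z - cnj z) powr s * F z) (cnj z)"
      using eichler_cnj_has_wirtinger[OF F a, of "cnj z" s] that by simp
    from has_wirtinger_cnj[OF has_wirtinger_compose_cnj[OF this]] show ?thesis
      using that by (simp add: E_def diff_cnj_powr y_def Fb_def cnj_powr)
  qed
  \<comment> \<open>Schwarz reflection keeps \<open>\<phi>\<close> holomorphic, so it adds nothing
    to \<open>dzbar H\<close>.\<close>
  have \<eta>_hol: "\<eta> holomorphic_on upper"
    unfolding holomorphic_on_open[OF open_upper]
  proof
    fix z assume "z \<in> upper"
    then have "(\<phi> has_field_derivative deriv \<phi> (cnj z)) (at (cnj z))"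
      by (intro holomorphic_derivI[OF \<phi> open_lower]) simp
    from has_field_derivative_cnj_cnj[OF this]
    show "\<exists>f'. (\<eta> has_field_derivative f') (at z)"
      by (auto simp: \<eta>_def o_def)
  qed
  then have \<eta>1_hol: "deriv \<eta> holomorphic_on upper" and \<eta>2_hol: "deriv (deriv \<eta>) holomorphic_on upper"
    by (auto intro!: holomorphic_deriv open_upper)
  have hol: "has_wirtinger f (deriv f z) 0 z" if "f holomorphic_on upper" "Im z > 0" for f z
    using that by (intro has_wirtinger_holomorphic holomorphic_derivI[OF _ open_upper]) auto
  have Fb: "has_wirtinger Fb 0 (cnj (deriv F z)) z" if "Im z > 0" for z
    using has_wirtinger_cnj[OF hol[OF F that]] by (simp add: Fb_def)
  have y: "has_wirtinger (y p) (p / (2 * \<i>) * y (p - 1) z) (- p / (2 * \<i>) * y (p - 1) z) z"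
    if "Im z > 0" for p z
    unfolding y_def by (rule has_wirtinger_Im_powr[OF that])
  define a0 where "a0 = (\<lambda>z. c * (cnj (- (r - 2)) * E (r - 3) z - deriv \<eta> z))"
  define b0 where "b0 = (\<lambda>z. \<i> / 2 * (y \<sigma> z * Fb z))"
  have H: "has_wirtinger H (a0 z) (b0 z) z" if "Im z > 0" for z
  proof -
    \<comment> \<open>This fixes the normalisation: the powers of \<open>- 2 * \<i>\<close> cancel
      and leave \<open>1 / (- 2 * \<i>)\<close>, which is \<open>\<i> / 2\<close>.\<close>
    have *: "c * (- 2 * \<i>) powr \<sigma> = \<i> / 2"
      using cnj_powr[of "2 * \<i>" "r - 2"] by (simp add: c_def \<sigma>_def field_simps)
    have "H = (\<lambda>z. c * (E (r - 2) z - \<eta> z))"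
      by (simp add: H_def c_def E_def \<eta>_def)
    moreover have "r - 2 - 1 = r - 3" by simp
    ultimately show ?thesis
      using has_wirtinger_cmult[OF has_wirtinger_diff[OF E[OF that, of "r - 2"] hol[OF \<eta>_hol that]], of c]
      by (simp add: a0_def b0_def \<sigma>_def[symmetric] mult.assoc *[symmetric])
  qed
  have b0: "has_wirtinger b0 (\<i> / 2 * (\<sigma> / (2 * \<i>) * y (\<sigma> - 1) z * Fb z))
     (\<i> / 2 * (- \<sigma> / (2 * \<i>) * y (\<sigma> - 1) z * Fb z + y \<sigma> z * cnj (deriv F z))) z" if "Im z > 0" for z
    using has_wirtinger_cmult[OF has_wirtinger_mult[OF y[OF that, of \<sigma>] Fb[OF that]], of "\<i> / 2"]
    by (simp add: b0_def)
  \<comment> \<open>The second derivative lowers the exponent once more, from \<open>r - 3\<close>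
    to \<open>r - 4\<close>.\<close>
  have a0: "has_wirtinger a0 (c * (cnj (- (r - 2)) * (cnj (- (r - 3)) * E (r - 4) z) - deriv (deriv \<eta>) z))
     (c * (cnj (- (r - 2)) * ((- 2 * \<i>) powr cnj (r - 3) * y (cnj (r - 3)) z * Fb z) - 0)) z" if "Im z > 0" for z
  proof -
    have "r - 3 - 1 = r - 4" by simp
    with E[OF that, of "r - 3"] have "has_wirtinger (E (r - 3)) (cnj (- (r - 3)) * E (r - 4) z)
        ((- 2 * \<i>) powr cnj (r - 3) * y (cnj (r - 3)) z * Fb z) z"
      by (simp only:)
    then show ?thesis
      unfolding a0_def by (intro has_wirtinger_cmult has_wirtinger_diff hol[OF \<eta>1_hol that])
  qed
  have [continuous_intros]: "continuous_on upper (E s)" "continuous_on upper (y p)" for s p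
    by (rule has_wirtinger_continuous_on, rule E y, simp)+
  have [continuous_intros]: "continuous_on upper Fb"
    by (rule has_wirtinger_continuous_on, rule Fb, simp)
  have [continuous_intros]: "continuous_on upper (deriv (deriv \<eta>))" "continuous_on upper (deriv F)"
    using \<eta>2_hol holomorphic_deriv[OF F open_upper] by (auto intro: holomorphic_on_imp_continuous_on)
  show "C2_on upper H"
    by (rule C2_onI[OF open_upper H a0 b0]) (auto intro!: continuous_intros)
  have db: "dzbar H z = b0 z" if "Im z > 0" for z
    using has_wirtinger_dz_dzbar[OF H[OF that]] by simp
  have ypow: "y (p + q) z = y p z * y q z" for p q z
    by (simp add: y_def powr_add)
  have y1: "y 1 z = of_real (Im z)" if "Im z > 0" for z
    using that by (simp add: y_def powr_def Ln_of_real exp_of_real)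
  show "Delta (2 - cnj r) H z = 0" if "Im z > 0" for z
  proof -
    have "has_wirtinger (dzbar H) (\<i> / 2 * (\<sigma> / (2 * \<i>) * y (\<sigma> - 1) z * Fb z))
     (\<i> / 2 * (- \<sigma> / (2 * \<i>) * y (\<sigma> - 1) z * Fb z + y \<sigma> z * cnj (deriv F z))) z"
      using b0[OF that] open_upper by (rule has_wirtinger_transform) (use that db in auto)
    then have "dz (dzbar H) z = \<i> / 2 * (\<sigma> / (2 * \<i>) * y (\<sigma> - 1) z * Fb z)"
      by (rule has_wirtinger_dz_dzbar)
    moreover have "y \<sigma> z = y (\<sigma> - 1) z * of_real (Im z)"
      using ypow[of "\<sigma> - 1" 1] y1[OF that] by simp
    \<comment> \<open>With weight \<open>- \<sigma>\<close> the two terms of \<open>Delta\<close>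
      are \<open>2 * \<i> * \<sigma> * y\<close> and \<open>- 2 * \<i> * \<sigma> * y\<close> times
      \<open>dzbar H\<close>.\<close>
    moreover have "2 - cnj r = - \<sigma>" by (simp add: \<sigma>_def)
    ultimately show ?thesis
      unfolding Delta_def db[OF that] b0_def
      by (simp only:) (simp (no_asm) add: power2_eq_square field_simps)
  qed
  show "2 * \<i> * of_real (Im z) powr (2 - r) * cnj (dzbar H z) = F z" if "Im z > 0" for z
  proof -
    have "cnj (y \<sigma> z) = y (r - 2) z"
      using that by (simp add: y_def \<sigma>_def cnj_powr)
    moreover have "y (2 - r) z * y (r - 2) z = 1"
      using that by (simp add: y_def flip: powr_add)
    moreover have "2 * \<i> * y (2 - r) z * cnj (dzbar H z) = y (2 - r) z * cnj (y \<sigma> z) * F z"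
      by (simp add: db[OF that] b0_def Fb_def algebra_simps)
    ultimately have "2 * \<i> * y (2 - r) z * cnj (dzbar H z) = F z"
      by simp
    then show ?thesis
      by (simp only: y_def)
  qed
qed

text \<open>The prescribed \<open>dzbar H\<close> makes the antilinear coefficients of both terms
  equal, so their difference satisfies the Cauchy-Riemann equation.\<close>

lemma eichler_minus_reflected_holomorphic:
  assumes F: "F holomorphic_on upper" and a: "Im a > 0"
    and H: "\<And>z. Im z > 0 \<Longrightarrow> H differentiable (at z)"
    and HF: "\<And>z. Im z > 0 \<Longrightarrow> 2 * \<i> * of_real (Im z) powr (2 - r) * cnj (dzbar H z) = F z"
  shows "(\<lambda>t. eichler (r - 2) F a t (cnj t) - 2 * \<i> * (2 * \<i>) powr (r - 2) * cnj (H (cnj t))) holomorphic_on lower"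
  unfolding holomorphic_on_open[OF open_lower]
proof
  fix t assume "t \<in> lower"
  then have t: "Im t < 0" and t': "Im (cnj t) > 0" by simp_all
  define c where "c = 2 * \<i> * (2 * \<i>) powr (r - 2)"
  have "has_wirtinger (\<lambda>t. c * cnj (H (cnj t))) (c * cnj (dz H (cnj t))) (c * cnj (dzbar H (cnj t))) t"
    by (intro has_wirtinger_cmult has_wirtinger_cnj[where f = "\<lambda>t. H (cnj t)"]
      has_wirtinger_compose_cnj differentiable_has_wirtinger H t')
  moreover have "c * cnj (dzbar H (cnj t)) = (cnj t - t) powr (r - 2) * F (cnj t)"
  proof -
    have "of_real (Im (cnj t)) powr (r - 2) * of_real (Im (cnj t)) powr (2 - r) = (1 :: complex)"
      using t by (simp flip: powr_add)
    then show ?thesis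
      using diff_cnj_powr[OF t', of "r - 2"] by (simp add: HF[OF t', symmetric] c_def)
  qed
  ultimately have "has_wirtinger (\<lambda>t. eichler (r - 2) F a t (cnj t) - c * cnj (H (cnj t)))
     (- (r - 2) * eichler (r - 2 - 1) F a t (cnj t) - c * cnj (dz H (cnj t))) 0 t"
    using has_wirtinger_diff[OF eichler_cnj_has_wirtinger[OF F a t, of "r - 2"]] by fastforce
  then show "\<exists>f'. ((\<lambda>t. eichler (r - 2) F a t (cnj t) - 2 * \<i> * (2 * \<i>) powr (r - 2) * cnj (H (cnj t)))
      has_field_derivative f') (at t)"
    unfolding c_def by (blast intro: has_field_derivative_wirtinger)
qed

section \<open>Passage between coboundaries and invariant harmonic functions\<close>

lemma slash_lower_diff:
  "slash_lower v r g (\<lambda>t. \<phi> t - \<psi> t) t = slash_lower v r g \<phi> t - slash_lower v r g \<psi> t"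
  by (simp add: slash_lower_def right_diff_distrib)

theorem theoremC:
  fixes G :: "mat2 set" and r :: complex and v :: "mat2 \<Rightarrow> complex"
    and F :: "complex \<Rightarrow> complex" and z0 :: complex
  assumes "cofinite_with_cusps G"
    and "multiplier_system G r v"
    and "F \<in> A_space G r v"
    and "z0 \<in> upper"
  shows "image_class_vanishes G r v z0 F \<longleftrightarrow>
    (\<exists>H\<in>harm_space G r v. \<forall>z\<in>upper.
        2 * \<i> * of_real (Im z) powr (2 - r) * cnj (dzbar H z) = F z)"
proof -
  define \<Phi> where "\<Phi> = (\<lambda>t. eichler (r - 2) F z0 t (cnj t))"
  define c where "c = 2 * \<i> * (2 * \<i>) powr (r - 2)"
  have c: "c \<noteq> 0" by (simp add: c_def)
  have G: "discrete_subgroup_SL2 G"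
    using assms(1) by (simp add: cofinite_with_cusps_def)
  then have det: "det g = 1" if "g \<in> G" for g
    using that by (simp add: discrete_subgroup_SL2_def)
  have F: "F holomorphic_on upper" and z0: "Im z0 > 0"
    using assms(3,4) by (simp_all add: A_space_def)
  \<comment> \<open>The cocycle is already the coboundary of \<open>\<Phi>\<close> among arbitrary
    functions; the question is whether a holomorphic function can replace
    \<open>\<Phi>\<close>.\<close>
  have slash: "slash_lower v r g \<Phi> t - \<Phi> t = psi z0 r F g t" if g: "g \<in> G" and t: "Im t < 0" for g t
    unfolding \<Phi>_def
  proof (rule slash_eichler_diff[of F g v r, OF F det[OF g] _ _ inverse_moeb[OF G g z0] z0 t])
    show vg: "v g \<noteq> 0"
      using assms(2) g by (simp add: multiplier_system_def)
    fix w assume w: "Im w > 0"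
    have "inverse (v g) * cfac g w powr (- r) * F (moeb g w) = F w"
      using assms(3) g w by (simp add: A_space_def)
    then show "F (moeb g w) = v g * cfac g w powr r * F w"
      using vg cfac_nonzero[OF det[OF g], of w] w by (simp add: powr_minus field_simps)
  qed
  show ?thesis
  proof
    assume "image_class_vanishes G r v z0 F"
    then obtain \<phi> where \<phi>: "\<phi> holomorphic_on lower"
      and cob: "\<And>g t. g \<in> G \<Longrightarrow> Im t < 0 \<Longrightarrow> psi z0 r F g t = slash_lower v r g \<phi> t - \<phi> t"
      by (auto simp: image_class_vanishes_def coboundary_in_def D_minus_omega_def)
    \<comment> \<open>Obtained by solving \<open>\<Phi> t - \<phi> t = c * cnj (H (cnj t))\<close>
      for \<open>H\<close>.\<close>
    define H where "H = (\<lambda>z. cnj (inverse c * (eichler (r - 2) F z0 (cnj z) z - \<phi> (cnj z))))"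
    have H: "(\<lambda>t. \<Phi> t - \<phi> t) = (\<lambda>t. c * cnj (H (cnj t)))"
      using c by (auto simp: H_def \<Phi>_def field_simps)
    have inv: "inverse (cnj (v g)) * cfac g z powr (cnj r - 2) * H (moeb g z) = H z"
      if g: "g \<in> G" and z: "Im z > 0" for g z
    proof -
      \<comment> \<open>Since \<open>\<Phi>\<close> and \<open>\<phi>\<close> have the same
        coboundary, their difference is invariant.\<close>
      have "slash_lower v r g (\<lambda>t. \<Phi> t - \<phi> t) (cnj z) = \<Phi> (cnj z) - \<phi> (cnj z)"
        using slash[OF g, of "cnj z"] cob[OF g, of "cnj z"] z by (simp add: slash_lower_diff algebra_simps)
      then have "slash_lower v r g (\<lambda>t. c * cnj (H (cnj t))) (cnj z) = c * cnj (H (cnj (cnj z)))"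
        unfolding H using H by metis
      then show ?thesis
        using harm_space_reflect_iff[OF det[OF g], of "cnj z" v r c H] z c by simp
    qed
    have "H \<in> harm_space G r v" and "\<forall>z\<in>upper. 2 * \<i> * of_real (Im z) powr (2 - r) * cnj (dzbar H z) = F z"
      using eichler_reflected_harmonic[where r = r, OF F z0 \<phi>] inv
      by (auto simp: harm_space_def H_def c_def)
    then show "\<exists>H\<in>harm_space G r v. \<forall>z\<in>upper.
        2 * \<i> * of_real (Im z) powr (2 - r) * cnj (dzbar H z) = F z"
      by blast
  next
    assume "\<exists>H\<in>harm_space G r v. \<forall>z\<in>upper.
        2 * \<i> * of_real (Im z) powr (2 - r) * cnj (dzbar H z) = F z"
    then obtain H where H: "H \<in> harm_space G r v"
      and HF: "\<And>z. Im z > 0 \<Longrightarrow> 2 * \<i> * of_real (Im z) powr (2 - r) * cnj (dzbar H z) = F z"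
      by auto
    define \<phi> where "\<phi> = (\<lambda>t. \<Phi> t - c * cnj (H (cnj t)))"
    have "\<phi> holomorphic_on lower"
      using eichler_minus_reflected_holomorphic[OF F z0 _ HF] H
      by (simp add: \<phi>_def \<Phi>_def c_def harm_space_def C2_on_def C1_on_def)
    \<comment> \<open>The subtracted reflection of \<open>H\<close> is invariant, so
      \<open>\<phi>\<close> inherits the coboundary of \<open>\<Phi>\<close>.\<close>
    moreover have "psi z0 r F g t = slash_lower v r g \<phi> t - \<phi> t" if g: "g \<in> G" and t: "Im t < 0" for g t
    proof -
      have "slash_lower v r g (\<lambda>t. c * cnj (H (cnj t))) t = c * cnj (H (cnj t))"
        using harm_space_reflect_iff[OF det[OF g] t, of v r c H] H g t by (simp add: harm_space_def)
      then show ?thesis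
        using slash[OF g t] by (simp add: \<phi>_def slash_lower_diff)
    qed
    ultimately show "image_class_vanishes G r v z0 F"
      by (auto simp: image_class_vanishes_def coboundary_in_def D_minus_omega_def)
  qed
qed

end
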